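(* Let $\mu$ be a probability measure. Then there exist an equivalent norm $\|\cdot\|$ on $L^1(\mu)$ and positive constants $K_1$ and $K_2$ such that for every closed subspace $X$ of $L^1(\mu)$, the moduli of convexity and smoothness of $(X,\|\cdot\|)$ satisfy $$\text{(A)}\quad \delta_X(\varepsilon)\geq K_X\,\varepsilon^2 \ \text{ for } 0<\varepsilon\leq 2,\qquad\text{where } K_X=K_1\sup_{0<t<1} t^2 C_X(t)^3,$$ and $$\text{(B)}\quad \rho_X(\tau)\leq K_2\,\tau^2\int_0^{1/\tau} G_X(t)\,dt\quad\text{for all }\tau>0.$$
   Context: For a Banach space $(X,\|\cdot\|)$ with unit sphere $S_X$, the modulus of convexity is $\delta_X(\varepsilon)=\inf\{1-\|\tfrac{x+y}{2}\| : x,y\in S_X,\ \|x-y\|=\varepsilon\}$ for $0<\varepsilon\le 2$, and the modulus of smoothness is $\rho_X(\tau)=\sup\{\tfrac{\|x+\tau y\|+\|x-\tau y\|}{2}-1 : x,y\in S_X\}$ for $\tau>0$. For $f\in L^1(\mu)$ let $F_f(t)=\mu(\{|f|>t\})$ be its distribution function. For a subspace $X\subset L^1(\mu)$ define $C_X(t)=\inf\{F_f(t): f\in X,\ \|f\|_1=1\}$ for $0<t<1$, and $G_X(t)=\sup\{\int_t^{\infty}F_f(u)\,du : f\in X,\ \|f\|_1=1\}$ for $t>0$. Here $\|\cdot\|_1$ is the usual $L^1$ norm; the moduli $\delta_X,\rho_X$ are computed with respect to the new norm $\|\cdot\|$ restricted to $X$. *)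

theory Defs
  imports "HOL-Probability.Probability"
begin

text \<open>Functions in L^1(mu) are represented by integrable real functions;
  all notions below are invariant under a.e. equality.\<close>

definition L1norm :: "'a measure \<Rightarrow> ('a \<Rightarrow> real) \<Rightarrow> real" where
  "L1norm M f = (\<integral>x. \<bar>f x\<bar> \<partial>M)"

definition equiv_L1_norm :: "'a measure \<Rightarrow> (('a \<Rightarrow> real) \<Rightarrow> real) \<Rightarrow> bool" where
  "equiv_L1_norm M N \<longleftrightarrow>
     (\<forall>f g. integrable M f \<longrightarrow> integrable M g \<longrightarrow> (AE x in M. f x = g x) \<longrightarrow> N f = N g) \<and>
     (\<forall>f g. integrable M f \<longrightarrow> integrable M g \<longrightarrow> N (\<lambda>x. f x + g x) \<le> N f + N g) \<and>
     (\<forall>f c. integrable M f \<longrightarrow> N (\<lambda>x. c * f x) = \<bar>c\<bar> * N f) \<and>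
     (\<exists>a b. 0 < a \<and> 0 < b \<and>
        (\<forall>f. integrable M f \<longrightarrow> a * L1norm M f \<le> N f \<and> N f \<le> b * L1norm M f))"

text \<open>Closed linear subspace of L^1(M) (as a set of integrable functions; closedness
  in the L^1 norm also makes it saturated under a.e. equality).\<close>
definition closed_L1_subspace :: "'a measure \<Rightarrow> ('a \<Rightarrow> real) set \<Rightarrow> bool" where
  "closed_L1_subspace M X \<longleftrightarrow>
     (\<forall>f\<in>X. integrable M f) \<and> (\<lambda>x. 0) \<in> X \<and>
     (\<forall>f\<in>X. \<forall>g\<in>X. (\<lambda>x. f x + g x) \<in> X) \<and>
     (\<forall>f\<in>X. \<forall>c. (\<lambda>x. c * f x) \<in> X) \<and>
     (\<forall>F f. (\<forall>n. F n \<in> X) \<longrightarrow> integrable M f \<longrightarrow>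
        (\<lambda>n. L1norm M (\<lambda>x. F n x - f x)) \<longlonglongrightarrow> 0 \<longrightarrow> f \<in> X)"

definition unit_sphere :: "(('a \<Rightarrow> real) \<Rightarrow> real) \<Rightarrow> ('a \<Rightarrow> real) set \<Rightarrow> ('a \<Rightarrow> real) set" where
  "unit_sphere N X = {f \<in> X. N f = 1}"

text \<open>Modulus of convexity (infimum in the extended reals; empty infimum is +infinity).\<close>
definition mod_convexity :: "(('a \<Rightarrow> real) \<Rightarrow> real) \<Rightarrow> ('a \<Rightarrow> real) set \<Rightarrow> real \<Rightarrow> ereal" where
  "mod_convexity N X \<epsilon> = Inf {ereal (1 - N (\<lambda>z. (f z + g z) / 2)) | f g.
      f \<in> unit_sphere N X \<and> g \<in> unit_sphere N X \<and> N (\<lambda>z. f z - g z) = \<epsilon>}"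

definition mod_smoothness :: "(('a \<Rightarrow> real) \<Rightarrow> real) \<Rightarrow> ('a \<Rightarrow> real) set \<Rightarrow> real \<Rightarrow> ereal" where
  "mod_smoothness N X \<tau> = Sup {ereal ((N (\<lambda>z. f z + \<tau> * g z) + N (\<lambda>z. f z - \<tau> * g z)) / 2 - 1) | f g.
      f \<in> unit_sphere N X \<and> g \<in> unit_sphere N X}"

definition distfun :: "'a measure \<Rightarrow> ('a \<Rightarrow> real) \<Rightarrow> real \<Rightarrow> real" where
  "distfun M f t = measure M {x \<in> space M. t < \<bar>f x\<bar>}"

definition C_X :: "'a measure \<Rightarrow> ('a \<Rightarrow> real) set \<Rightarrow> real \<Rightarrow> ereal" where
  "C_X M X t = Inf {ereal (distfun M f t) | f. f \<in> X \<and> L1norm M f = 1}"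

definition G_X :: "'a measure \<Rightarrow> ('a \<Rightarrow> real) set \<Rightarrow> real \<Rightarrow> ennreal" where
  "G_X M X t = Sup {(\<integral>\<^sup>+ u. ennreal (distfun M f u) * indicator {t..} u \<partial>lborel) | f.
      f \<in> X \<and> L1norm M f = 1}"

definition K_X :: "'a measure \<Rightarrow> ('a \<Rightarrow> real) set \<Rightarrow> real \<Rightarrow> ereal" where
  "K_X M X K1 = ereal K1 * Sup {ereal (t^2) * C_X M X t ^ 3 | t. 0 < t \<and> t < 1}"

end

theory Submission
  imports Defs
begin

text \<open>
  The norm is the Luxemburg norm of the Orlicz function \<open>phi t = \<bar>t\<bar> - ln (1 + \<bar>t\<bar>)\<close>, whose second
  derivative is \<open>1 / (1 + \<bar>t\<bar>)\<^sup>2\<close>; unit vectors \<open>f\<close> are those with \<open>\<integral>phi(f) = 1\<close>.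

  For (A), let \<open>c = C_X(t)\<close>. By Markov's inequality two unit vectors \<open>f\<close>, \<open>g\<close> are bounded by \<open>a = 12/c\<close>
  on a set of measure at least \<open>c/2\<close> where also \<open>\<bar>f - g\<bar> > t \<epsilon>\<close>. There the convexity of \<open>phi\<close> gains
  a multiple of \<open>t\<^sup>2 \<epsilon>\<^sup>2 / (1 + a)\<^sup>2\<close>, that is, a multiple of \<open>t\<^sup>2 \<epsilon>\<^sup>2 c\<^sup>2\<close>.

  For (B), the second order remainder of \<open>phi\<close> is at most \<open>2 min(d\<^sup>2, \<bar>d\<bar>)\<close>. With \<open>A\<close>, \<open>B\<close> the norms of
  \<open>f \<plusminus> \<tau>g\<close>, expanding \<open>phi\<close> at \<open>w = 2f/(A + B)\<close>, the average of \<open>(f + \<tau>g)/A\<close> and \<open>(f - \<tau>g)/B\<close> with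
  weights proportional to \<open>A\<close> and \<open>B\<close>, makes the first order terms cancel. The remainder is controlled
  by \<open>\<integral>min((\<tau>h)\<^sup>2, \<tau>\<bar>h\<bar>)\<close> for \<open>h = f, g\<close>, and by the layer cake formula this is at most a multiple of
  \<open>\<tau>\<^sup>2\<close> times the integral of \<open>G_X\<close> over \<open>[0, 1/\<tau>]\<close>.
\<close>

section \<open>The Orlicz function \<open>phi\<close>: growth, derivative and convexity\<close>

definition phi :: "real \<Rightarrow> real" where
  "phi t = \<bar>t\<bar> - ln (1 + \<bar>t\<bar>)"

lemma phi_0 [simp]: "phi 0 = 0"
  by (simp add: phi_def)

lemma phi_abs [simp]: "phi \<bar>t\<bar> = phi t"
  by (simp add: phi_def)

lemma phi_nonneg [simp]: "0 \<le> phi t"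
  using ln_add_one_self_le_self[of "\<bar>t\<bar>"] by (simp add: phi_def)

lemma phi_le_abs: "phi t \<le> \<bar>t\<bar>"
  by (simp add: phi_def)

text \<open>Splitting off \<open>ln 2\<close> before using \<open>ln y <= y - 1\<close> gives away
  only half of the slope of \<open>|t|\<close>. The remaining linear growth lets the Luxemburg norm
  dominate the \<open>L1norm\<close> on a probability space.\<close>

lemma phi_ge_half_abs: "\<bar>t\<bar> / 2 - 1 / 2 \<le> phi t"
proof -
  have "ln (1 + \<bar>t\<bar>) = ln 2 + ln ((1 + \<bar>t\<bar>) / 2)"
    by (simp add: ln_div)
  also have "\<dots> \<le> 1 + ((1 + \<bar>t\<bar>) / 2 - 1)"
    using ln_le_minus_one[of "2 :: real"] ln_le_minus_one[of "(1 + \<bar>t\<bar>) / 2"]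
    by (intro add_mono) auto
  finally show ?thesis
    by (simp add: phi_def field_simps)
qed

text \<open>This serves the derivative at 0, where the absolute value rules out the usual
  differentiation rules: the difference quotient of \<open>phi\<close> is squeezed by
  \<open>|h|\<close>.\<close>

lemma phi_le_square: "phi t \<le> t\<^sup>2"
proof -
  have "\<bar>t\<bar> - \<bar>t\<bar>\<^sup>2 \<le> ln (1 + \<bar>t\<bar>)"
  proof (cases "\<bar>t\<bar> \<le> 1")
    case True
    then show ?thesis using ln_one_plus_pos_lower_bound[of "\<bar>t\<bar>"] by simp
  next
    case False
    then have "\<bar>t\<bar> * 1 \<le> \<bar>t\<bar> * \<bar>t\<bar>"
      by (intro mult_left_mono) auto
    moreover have "0 \<le> ln (1 + \<bar>t\<bar>)"
      by simp
    ultimately show ?thesis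
      unfolding power2_eq_square by linarith
  qed
  then show ?thesis by (simp add: phi_def)
qed

lemma phi_has_derivative: "(phi has_real_derivative t / (1 + \<bar>t\<bar>)) (at t)"
proof -
  consider "t > 0" | "t < 0" | "t = 0" by linarith
  then show ?thesis
  proof cases
    case 1
    have "((\<lambda>t. t - ln (1 + t)) has_real_derivative t / (1 + \<bar>t\<bar>)) (at t)"
      using 1 by (auto intro!: derivative_eq_intros simp: field_simps)
    then show ?thesis
      by (rule has_field_derivative_transform_within_open[where S = "{0<..}"])
        (use 1 in \<open>auto simp: phi_def\<close>)
  next
    case 2
    have "((\<lambda>t. - t - ln (1 - t)) has_real_derivative t / (1 + \<bar>t\<bar>)) (at t)"
      using 2 by (auto intro!: derivative_eq_intros simp: field_simps)
    then show ?thesis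
      by (rule has_field_derivative_transform_within_open[where S = "{..<0}"])
        (use 2 in \<open>auto simp: phi_def\<close>)
  next
    case 3
    have "((\<lambda>h. phi h / h) \<longlongrightarrow> 0) (at 0)"
    proof (rule Lim_null_comparison)
      have "norm (phi h / h) \<le> \<bar>h\<bar>" for h
        using phi_le_square[of h]
        by (cases "h = 0") (auto simp: divide_simps power2_eq_square)
      then show "\<forall>\<^sub>F h in at 0. norm (phi h / h) \<le> \<bar>h\<bar>"
        by (simp add: always_eventually)
      show "((\<lambda>h::real. \<bar>h\<bar>) \<longlongrightarrow> 0) (at 0)"
        by (intro tendsto_eq_intros) auto
    qed
    then show ?thesis
      using 3 by (simp add: DERIV_def)
  qed
qed

text \<open>A first order form of \<open>phi'' >= 1 / (1 + a)^2\<close> on \<open>[-a, a]\<close>.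
  Over the common denominator, which is at most \<open>(1 + a)^2\<close>, the numerator is
  \<open>y - x\<close> plus \<open>y * |x| - x * |y|\<close>; the extra term vanishes for equal
  signs and is nonnegative when \<open>x\<close> and \<open>y\<close> lie on opposite sides of
  0.\<close>

lemma phi_deriv_diff_ge:
  fixes x y a :: real
  assumes "x \<le> y" "\<bar>x\<bar> \<le> a" "\<bar>y\<bar> \<le> a"
  shows "(y - x) / (1 + a)\<^sup>2 \<le> y / (1 + \<bar>y\<bar>) - x / (1 + \<bar>x\<bar>)"
proof -
  have "(y - x) / (1 + a)\<^sup>2 \<le> (y - x) / ((1 + \<bar>y\<bar>) * (1 + \<bar>x\<bar>))"
  proof (rule frac_le)
    show "(1 + \<bar>y\<bar>) * (1 + \<bar>x\<bar>) \<le> (1 + a)\<^sup>2"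
      unfolding power2_eq_square using assms by (intro mult_mono) auto
    show "0 < (1 + \<bar>y\<bar>) * (1 + \<bar>x\<bar>)"
      by (intro mult_pos_pos) auto
  qed (use assms in auto)
  also have "\<dots> \<le> (y * (1 + \<bar>x\<bar>) - x * (1 + \<bar>y\<bar>)) / ((1 + \<bar>y\<bar>) * (1 + \<bar>x\<bar>))"
  proof (rule divide_right_mono)
    have "x * \<bar>y\<bar> \<le> y * \<bar>x\<bar>"
      using assms mult_nonneg_nonneg[of y "- x"] by (auto simp: abs_if mult.commute)
    then show "y - x \<le> y * (1 + \<bar>x\<bar>) - x * (1 + \<bar>y\<bar>)"
      by (simp add: algebra_simps)
  qed auto
  also have "\<dots> = y / (1 + \<bar>y\<bar>) - x / (1 + \<bar>x\<bar>)"
    by (subst diff_frac_eq) (auto simp: add_pos_nonneg add_nonneg_eq_0_iff)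
  finally show ?thesis .
qed

text \<open>By the preceding lemma \<open>phi\<close> minus \<open>k * t^2 / 2\<close> still has an
  increasing derivative on \<open>[-a, a]\<close>, hence is convex there. Midpoint convexity of this
  difference, with the parallelogram identity for the quadratic part, leaves the gap
  \<open>k * (x - y)^2 / 8\<close>.\<close>

lemma phi_convexity_gap:
  assumes "\<bar>x\<bar> \<le> a" "\<bar>y\<bar> \<le> a"
  shows "(x - y)\<^sup>2 / (8 * (1 + a)\<^sup>2) \<le> (phi x + phi y) / 2 - phi ((x + y) / 2)"
proof -
  define k where "k = 1 / (1 + a)\<^sup>2"
  have "convex_on {-a..a} (\<lambda>t. phi t - k * t\<^sup>2 / 2)"
  proof (rule convex_on_realI[where f' = "\<lambda>t. t / (1 + \<bar>t\<bar>) - k * t"])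
    show "connected {-a..a}" by simp
    show "((\<lambda>t. phi t - k * t\<^sup>2 / 2) has_real_derivative t / (1 + \<bar>t\<bar>) - k * t) (at t)" for t
      by (auto intro!: derivative_eq_intros phi_has_derivative)
    show "x / (1 + \<bar>x\<bar>) - k * x \<le> y / (1 + \<bar>y\<bar>) - k * y"
      if "x \<in> {-a..a}" "y \<in> {-a..a}" "x \<le> y" for x y
      using phi_deriv_diff_ge[of x y a] that by (auto simp: k_def algebra_simps diff_divide_distrib)
  qed
  then have "phi ((1 - 1/2) *\<^sub>R x + (1/2) *\<^sub>R y) - k * ((1 - 1/2) *\<^sub>R x + (1/2) *\<^sub>R y)\<^sup>2 / 2
      \<le> (1 - 1/2) * (phi x - k * x\<^sup>2 / 2) + (1/2) * (phi y - k * y\<^sup>2 / 2)"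
    using assms by (intro convex_onD[where A = "{-a..a}"]) auto
  also have "(1 - 1/2) *\<^sub>R x + (1/2) *\<^sub>R y = (x + y) / 2"
    by (simp add: field_simps)
  finally have "phi ((x + y) / 2) - k * ((x + y) / 2)\<^sup>2 / 2
      \<le> (phi x - k * x\<^sup>2 / 2) / 2 + (phi y - k * y\<^sup>2 / 2) / 2"
    by simp
  moreover have "k * (x\<^sup>2 + y\<^sup>2) / 4 - k * ((x + y) / 2)\<^sup>2 / 2 = k * (x - y)\<^sup>2 / 8"
    by (simp add: field_simps power2_eq_square)
  moreover have "(x - y)\<^sup>2 / (8 * (1 + a)\<^sup>2) = k * (x - y)\<^sup>2 / 8"
    by (simp add: k_def)
  ultimately show ?thesis
    by (simp add: field_simps)
qed

lemma convex_on_phi: "convex_on UNIV phi"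
proof (rule convex_on_realI[where f' = "\<lambda>t. t / (1 + \<bar>t\<bar>)"])
  show "x / (1 + \<bar>x\<bar>) \<le> y / (1 + \<bar>y\<bar>)" if "x \<le> y" for x y :: real
  proof -
    have "0 \<le> (y - x) / (1 + max \<bar>x\<bar> \<bar>y\<bar>)\<^sup>2"
      using that by simp
    also have "\<dots> \<le> y / (1 + \<bar>y\<bar>) - x / (1 + \<bar>x\<bar>)"
      using that by (intro phi_deriv_diff_ge) auto
    finally show ?thesis by simp
  qed
qed (auto intro: phi_has_derivative)

lemma phi_convex:
  assumes "0 \<le> u" "0 \<le> v" "u + v = 1"
  shows "phi (u * x + v * y) \<le> u * phi x + v * phi y"
  using convex_on_phi assms unfolding convex_on_def by auto

lemma phi_contract: "0 \<le> u \<Longrightarrow> u \<le> 1 \<Longrightarrow> phi (u * x) \<le> u * phi x"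
  using phi_convex[of u "1 - u" x 0] by simp

text \<open>The doubling condition of Orlicz space theory, in quadratic form. Both sides vanish at
  0, and on the positive axis the derivative of their difference is a positive multiple of
  \<open>x / (1 + x) - x / (1 + l * x)\<close>; evenness covers negative \<open>t\<close>.\<close>

lemma phi_scale_le:
  assumes "1 \<le> l"
  shows "phi (l * t) \<le> l\<^sup>2 * phi t"
proof -
  have "l\<^sup>2 * phi 0 - phi (l * 0) \<le> l\<^sup>2 * phi \<bar>t\<bar> - phi (l * \<bar>t\<bar>)"
  proof (rule DERIV_nonneg_imp_nondecreasing[OF abs_ge_zero])
    fix x :: real assume "0 \<le> x" "x \<le> \<bar>t\<bar>"
    have *: "((\<lambda>x. phi (l * x)) has_real_derivative l * (l * x / (1 + \<bar>l * x\<bar>))) (at x)"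
      by (rule DERIV_cong[OF DERIV_chain2[OF phi_has_derivative]])
        (auto intro!: derivative_eq_intros)
    show "\<exists>y. ((\<lambda>x. l\<^sup>2 * phi x - phi (l * x)) has_real_derivative y) (at x) \<and> 0 \<le> y"
    proof (intro exI conjI)
      show "((\<lambda>x. l\<^sup>2 * phi x - phi (l * x)) has_real_derivative
          (l\<^sup>2 * (x / (1 + \<bar>x\<bar>)) - l * (l * x / (1 + \<bar>l * x\<bar>)))) (at x)"
        by (intro DERIV_diff DERIV_cmult phi_has_derivative *)
      have "x / (1 + l * x) \<le> x / (1 + x)"
        using assms \<open>0 \<le> x\<close> mult_right_mono[of 1 l x]
        by (intro divide_left_mono) (auto intro!: mult_pos_pos add_pos_nonneg)
      then have "l\<^sup>2 * (x / (1 + l * x)) \<le> l\<^sup>2 * (x / (1 + x))"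
        by (rule mult_left_mono) simp
      then show "0 \<le> l\<^sup>2 * (x / (1 + \<bar>x\<bar>)) - l * (l * x / (1 + \<bar>l * x\<bar>))"
        using assms \<open>0 \<le> x\<close> by (simp add: power2_eq_square mult.assoc)
    qed
  qed
  moreover have "phi (l * \<bar>t\<bar>) = phi (l * t)"
    by (subst phi_abs[symmetric], subst (2) phi_abs[symmetric]) (simp add: abs_mult del: phi_abs)
  ultimately show ?thesis by simp
qed

section \<open>The comparison function \<open>msq\<close> and the second order remainder of
  \<open>phi\<close>\<close>

text \<open>Up to constants this is \<open>phi\<close> itself, quadratic near 0 and linear at
  infinity, in a form suited to scaling and to the layer cake formula.\<close>

definition msq :: "real \<Rightarrow> real" where
  "msq t = min (t\<^sup>2) \<bar>t\<bar>"

lemma msq_nonneg [simp]: "0 \<le> msq t"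
  by (simp add: msq_def)

lemma msq_mono: "\<bar>s\<bar> \<le> \<bar>t\<bar> \<Longrightarrow> msq s \<le> msq t"
  unfolding msq_def by (intro min.mono) (auto simp: abs_le_square_iff)

lemma msq_scale_le: "1 \<le> l \<Longrightarrow> msq (l * t) \<le> l\<^sup>2 * msq t"
proof -
  assume "1 \<le> l"
  then have "l * \<bar>t\<bar> \<le> l\<^sup>2 * \<bar>t\<bar>"
    by (intro mult_right_mono) (auto simp: power2_eq_square)
  then show ?thesis
    using \<open>1 \<le> l\<close> by (auto simp: msq_def min_mult_distrib_left power_mult_distrib abs_mult min_le_iff_disj)
qed

text \<open>Since \<open>msq\<close> is even and increasing in the absolute value,
  \<open>s + t\<close> may be replaced by twice the larger of the two, and doubling costs a factor
  4.\<close>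

lemma msq_add_le: "msq (s + t) \<le> 4 * (msq s + msq t)"
proof -
  have "msq (s + t) \<le> msq (2 * max \<bar>s\<bar> \<bar>t\<bar>)"
    by (intro msq_mono) auto
  also have "\<dots> \<le> 2\<^sup>2 * msq (max \<bar>s\<bar> \<bar>t\<bar>)"
    by (rule msq_scale_le) simp
  also have "msq (max \<bar>s\<bar> \<bar>t\<bar>) \<le> msq s + msq t"
  proof (cases "\<bar>s\<bar> \<le> \<bar>t\<bar>")
    case True
    then have "msq (max \<bar>s\<bar> \<bar>t\<bar>) \<le> msq t" by (intro msq_mono) auto
    then show ?thesis using msq_nonneg[of s] by linarith
  next
    case False
    then have "msq (max \<bar>s\<bar> \<bar>t\<bar>) \<le> msq s" by (intro msq_mono) auto
    then show ?thesis using msq_nonneg[of t] by linarith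
  qed
  finally show ?thesis by simp
qed

text \<open>The offset is chosen for large \<open>\<tau>\<close>: \<open>\<tau> / 4 - 1 / 16\<close>
  is at least \<open>\<tau> / 8\<close> exactly when \<open>\<tau>\<close> is at least 1/2.\<close>

lemma msq_ge: "\<bar>t\<bar> / 4 - 1 / 16 \<le> msq t"
proof -
  have "0 \<le> (\<bar>t\<bar> - 1/8)\<^sup>2"
    by simp
  then have "\<bar>t\<bar> / 4 - 1 / 16 \<le> t\<^sup>2"
    by (simp add: power2_diff power_divide)
  then show ?thesis
    by (simp add: msq_def)
qed

text \<open>The derivative \<open>t / (1 + |t|)\<close> is 1-Lipschitz and bounded by 1, so its
  increment is at most the minimum of \<open>|d|\<close> and 2; the mean value theorem multiplies
  this by \<open>|d|\<close>.\<close>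

lemma phi_taylor:
  "phi (w + d) \<le> phi w + w / (1 + \<bar>w\<bar>) * d + 2 * msq d"
proof -
  have lip: "\<bar>y / (1 + \<bar>y\<bar>) - x / (1 + \<bar>x\<bar>)\<bar> \<le> min \<bar>y - x\<bar> 2" for x y :: real
  proof -
    have "\<bar>y * (1 + \<bar>x\<bar>) - x * (1 + \<bar>y\<bar>)\<bar> \<le> \<bar>y - x\<bar> * ((1 + \<bar>y\<bar>) * (1 + \<bar>x\<bar>))"
    proof -
      have "y * (1 + \<bar>x\<bar>) - x * (1 + \<bar>y\<bar>) = (y - x) + (y * \<bar>x\<bar> - x * \<bar>y\<bar>)"
        by (simp add: algebra_simps)
      then have "\<bar>y * (1 + \<bar>x\<bar>) - x * (1 + \<bar>y\<bar>)\<bar> \<le> \<bar>y - x\<bar> + \<bar>y * \<bar>x\<bar> - x * \<bar>y\<bar>\<bar>"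
        by linarith
      also have "\<bar>y * \<bar>x\<bar> - x * \<bar>y\<bar>\<bar> \<le> \<bar>y - x\<bar> * (\<bar>y\<bar> + \<bar>x\<bar>)"
      proof -
        show ?thesis
        proof (cases "0 \<le> x \<longleftrightarrow> 0 \<le> y")
          case True
          then have "y * \<bar>x\<bar> - x * \<bar>y\<bar> = 0" by (auto simp: abs_if)
          then show ?thesis by simp
        next
          case False
          then have "\<bar>y - x\<bar> = \<bar>y\<bar> + \<bar>x\<bar>" by (auto simp: abs_if)
          moreover have "\<bar>y * \<bar>x\<bar> - x * \<bar>y\<bar>\<bar> \<le> \<bar>y\<bar> * \<bar>x\<bar> + \<bar>x\<bar> * \<bar>y\<bar>"
            by (rule order_trans[OF abs_triangle_ineq4]) (simp add: abs_mult)
          moreover have "\<bar>y\<bar> * \<bar>x\<bar> + \<bar>x\<bar> * \<bar>y\<bar> \<le> (\<bar>y\<bar> + \<bar>x\<bar>) * (\<bar>y\<bar> + \<bar>x\<bar>)"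
            by (simp add: algebra_simps)
          ultimately show ?thesis by (simp add: add.commute)
        qed
      qed
      finally have "\<bar>y * (1 + \<bar>x\<bar>) - x * (1 + \<bar>y\<bar>)\<bar> \<le> \<bar>y - x\<bar> * (1 + (\<bar>y\<bar> + \<bar>x\<bar>))"
        by (simp add: algebra_simps)
      also have "\<dots> \<le> \<bar>y - x\<bar> * ((1 + \<bar>y\<bar>) * (1 + \<bar>x\<bar>))"
        by (intro mult_left_mono) (auto simp: algebra_simps)
      finally show ?thesis .
    qed
    moreover have "0 < (1 + \<bar>y\<bar>) * (1 + \<bar>x\<bar>)"
      by (intro mult_pos_pos) auto
    moreover have "y / (1 + \<bar>y\<bar>) - x / (1 + \<bar>x\<bar>)
        = (y * (1 + \<bar>x\<bar>) - x * (1 + \<bar>y\<bar>)) / ((1 + \<bar>y\<bar>) * (1 + \<bar>x\<bar>))"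
      by (subst diff_frac_eq) (auto simp: add_nonneg_eq_0_iff)
    ultimately have "\<bar>y / (1 + \<bar>y\<bar>) - x / (1 + \<bar>x\<bar>)\<bar> \<le> \<bar>y - x\<bar>"
      by (simp add: abs_divide pos_divide_le_eq del: abs_mult)
    moreover have "\<bar>z / (1 + \<bar>z\<bar>)\<bar> \<le> 1" for z :: real
      by (simp add: abs_divide)
    from this[of x] this[of y] have "\<bar>y / (1 + \<bar>y\<bar>) - x / (1 + \<bar>x\<bar>)\<bar> \<le> 2"
      by linarith
    ultimately show ?thesis by simp
  qed
  \<comment> \<open>\<open>MVT2\<close> wants an increasing interval, so the sign of
    \<open>d\<close> decides which of \<open>w\<close> and \<open>w + d\<close> is the left
    end.\<close>
  obtain z where z: "phi (w + d) - phi w = d * (z / (1 + \<bar>z\<bar>))" "\<bar>z - w\<bar> \<le> \<bar>d\<bar>"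
  proof -
    consider "d > 0" | "d = 0" | "d < 0" by linarith
    then show ?thesis
    proof cases
      case 1
      have "\<exists>z>w. z < w + d \<and> phi (w + d) - phi w = (w + d - w) * (z / (1 + \<bar>z\<bar>))"
        using 1 by (intro MVT2) (auto intro: phi_has_derivative)
      then show ?thesis using that by force
    next
      case 2
      then show ?thesis using that[of w] by simp
    next
      case 3
      have "\<exists>z>w + d. z < w \<and> phi w - phi (w + d) = (w - (w + d)) * (z / (1 + \<bar>z\<bar>))"
        using 3 by (intro MVT2) (auto intro: phi_has_derivative)
      then obtain z where "w + d < z" "z < w" "phi w - phi (w + d) = (w - (w + d)) * (z / (1 + \<bar>z\<bar>))"
        by blast
      then show ?thesis using that[of z] 3 by (auto simp: algebra_simps)
    qed
  qed
  have "phi (w + d) - phi w - w / (1 + \<bar>w\<bar>) * d = d * (z / (1 + \<bar>z\<bar>) - w / (1 + \<bar>w\<bar>))"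
    by (simp add: z(1) right_diff_distrib)
  also have "\<dots> \<le> \<bar>d\<bar> * \<bar>z / (1 + \<bar>z\<bar>) - w / (1 + \<bar>w\<bar>)\<bar>"
    by (metis abs_ge_self abs_mult)
  also have "\<dots> \<le> \<bar>d\<bar> * min \<bar>d\<bar> 2"
    using lip[of z w] z(2) by (intro mult_left_mono) auto
  also have "\<dots> \<le> 2 * msq d"
  proof -
    have "\<bar>d\<bar> * min \<bar>d\<bar> 2 \<le> \<bar>d\<bar> * \<bar>d\<bar>" "\<bar>d\<bar> * min \<bar>d\<bar> 2 \<le> \<bar>d\<bar> * 2"
      by (intro mult_left_mono; simp)+
    then show ?thesis
      using zero_le_square[of d] unfolding msq_def power2_eq_square abs_mult_self_eq by linarith
  qed
  finally show ?thesis by simp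
qed

section \<open>The modular and the Luxemburg norm\<close>

lemma borel_measurable_phi [measurable]: "phi \<in> borel_measurable borel"
  unfolding phi_def[abs_def] by measurable

lemma borel_measurable_msq [measurable]: "msq \<in> borel_measurable borel"
  unfolding msq_def[abs_def] by measurable

lemma integrable_phi:
  assumes "integrable M f"
  shows "integrable M (\<lambda>x. phi (f x))"
  by (rule Bochner_Integration.integrable_bound[OF integrable_abs[OF assms]])
    (use assms in \<open>auto simp: phi_le_abs\<close>)

lemma integrable_msq:
  assumes "integrable M f"
  shows "integrable M (\<lambda>x. msq (f x))"
  by (rule Bochner_Integration.integrable_bound[OF integrable_abs[OF assms]])
    (use assms in \<open>auto simp: msq_def\<close>)

definition modular :: "'a measure \<Rightarrow> ('a \<Rightarrow> real) \<Rightarrow> real" where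
  "modular M f = (\<integral>x. phi (f x) \<partial>M)"

definition luxemburg :: "'a measure \<Rightarrow> ('a \<Rightarrow> real) \<Rightarrow> real" where
  "luxemburg M f = Inf {k. 0 < k \<and> modular M (\<lambda>x. f x / k) \<le> 1}"

lemma modular_nonneg [simp]: "0 \<le> modular M f"
  by (simp add: modular_def)

lemma modular_scale_le:
  assumes "integrable M f" "1 \<le> l"
  shows "modular M (\<lambda>x. l * f x) \<le> l\<^sup>2 * modular M f"
  unfolding modular_def integral_mult_right_zero[symmetric] using assms
  by (intro integral_mono integrable_mult_right integrable_phi phi_scale_le)

lemma modular_divide_le:
  assumes "integrable M f" "0 < k" "k \<le> 1"
  shows "modular M (\<lambda>x. f x / k) \<le> modular M f / k\<^sup>2"
  using modular_scale_le[OF assms(1), of "1 / k"] assms(2,3)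
  by (simp add: power_divide)

lemma modular_contract:
  assumes "integrable M f" "0 \<le> u" "u \<le> 1"
  shows "modular M (\<lambda>x. u * f x) \<le> u * modular M f"
  unfolding modular_def integral_mult_right_zero[symmetric] using assms
  by (intro integral_mono integrable_mult_right integrable_phi phi_contract)

lemma modular_convex:
  assumes "integrable M f" "integrable M g" "0 \<le> u" "0 \<le> v" "u + v = 1"
  shows "modular M (\<lambda>x. u * f x + v * g x) \<le> u * modular M f + v * modular M g"
proof -
  have "modular M (\<lambda>x. u * f x + v * g x) \<le> (\<integral>x. u * phi (f x) + v * phi (g x) \<partial>M)"
    unfolding modular_def using assms
    by (intro integral_mono integrable_mult_right integrable_phi phi_convex Bochner_Integration.integrable_add)
  also have "\<dots> = u * modular M f + v * modular M g"
    unfolding modular_def using assms by (simp add: integrable_phi)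
  finally show ?thesis .
qed

lemma modular_le_L1norm:
  assumes "integrable M f"
  shows "modular M f \<le> L1norm M f"
  unfolding modular_def L1norm_def using assms
  by (intro integral_mono integrable_phi phi_le_abs integrable_abs)

lemma L1norm_nonneg [simp]: "0 \<le> L1norm M f"
  by (simp add: L1norm_def)

lemma L1norm_mult: "L1norm M (\<lambda>x. c * f x) = \<bar>c\<bar> * L1norm M f"
  by (simp add: L1norm_def abs_mult)

lemma L1norm_divide: "L1norm M (\<lambda>x. f x / c) = L1norm M f / \<bar>c\<bar>"
  by (simp add: L1norm_def abs_divide)

text \<open>The infimum is attained, and no limit theorem for integrals is needed to see it: each
  \<open>l > k\<close> is admissible by contraction, passing from \<open>f / l\<close> to
  \<open>f / k\<close> costs at most the factor \<open>(l / k)^2\<close>, and this factor tends to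
  1.\<close>

lemma luxemburg_le_iff:
  assumes f: "integrable M f" and k: "0 < k"
  shows "luxemburg M f \<le> k \<longleftrightarrow> modular M (\<lambda>x. f x / k) \<le> 1"
proof
  assume "modular M (\<lambda>x. f x / k) \<le> 1"
  then show "luxemburg M f \<le> k"
    unfolding luxemburg_def using k by (intro cInf_lower bdd_belowI[of _ 0]) auto
next
  assume le: "luxemburg M f \<le> k"
  \<comment> \<open>\<open>L\<close> is an admissible scale, so the infimum is not over the empty
    set; the summand 1 keeps it positive when \<open>f\<close> vanishes almost everywhere.\<close>
  define L where "L = L1norm M f + 1"
  have "L > 0"
    unfolding L_def using L1norm_nonneg[of M f] by linarith
  have "modular M (\<lambda>x. f x / L) \<le> L1norm M f / \<bar>L\<bar>"
    using modular_le_L1norm[of M "\<lambda>x. f x / L"] f by (simp add: L1norm_divide)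
  also have "\<dots> \<le> 1"
    using \<open>L > 0\<close> by (simp add: L_def)
  finally have ne: "{k. 0 < k \<and> modular M (\<lambda>x. f x / k) \<le> 1} \<noteq> {}"
    using \<open>L > 0\<close> by auto
  have *: "modular M (\<lambda>x. f x / k) \<le> (l / k)\<^sup>2" if "k < l" for l
  proof -
    have "luxemburg M f < l"
      using le that by simp
    then obtain j where j: "0 < j" "j < l" "modular M (\<lambda>x. f x / j) \<le> 1"
      unfolding luxemburg_def using cInf_lessD[OF ne] by blast
    have "(\<lambda>x. f x / l) = (\<lambda>x. j / l * (f x / j))"
      using j by auto
    then have "modular M (\<lambda>x. f x / l) \<le> j / l * modular M (\<lambda>x. f x / j)"
      using modular_contract[of M "\<lambda>x. f x / j" "j / l"] f j by simp
    also have "\<dots> \<le> 1 * 1"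
      using j by (intro mult_mono) auto
    finally have "modular M (\<lambda>x. f x / l) \<le> 1" by simp
    have "(\<lambda>x. f x / k) = (\<lambda>x. l / k * (f x / l))"
      using k that by auto
    then have "modular M (\<lambda>x. f x / k) \<le> (l / k)\<^sup>2 * modular M (\<lambda>x. f x / l)"
      using modular_scale_le[of M "\<lambda>x. f x / l" "l / k"] f k that by simp
    also have "\<dots> \<le> (l / k)\<^sup>2 * 1"
      using \<open>modular M (\<lambda>x. f x / l) \<le> 1\<close> by (intro mult_left_mono) auto
    finally show ?thesis by simp
  qed
  have "((\<lambda>l. (l / k)\<^sup>2) \<longlongrightarrow> (k / k)\<^sup>2) (at_right k)"
    by (intro tendsto_intros) (use k in auto)
  then have "modular M (\<lambda>x. f x / k) \<le> (k / k)\<^sup>2"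
    by (rule tendsto_lowerbound) (auto intro!: eventually_at_rightI[of k "k + 1"] *)
  then show "modular M (\<lambda>x. f x / k) \<le> 1"
    using k by simp
qed

lemma luxemburg_nonneg:
  assumes "integrable M f"
  shows "0 \<le> luxemburg M f"
proof (rule ccontr)
  assume neg: "\<not> 0 \<le> luxemburg M f"
  have "modular M (\<lambda>x. f x / (L1norm M f + 1)) \<le> L1norm M f / \<bar>L1norm M f + 1\<bar>"
    using modular_le_L1norm[of M "\<lambda>x. f x / (L1norm M f + 1)"] assms by (simp add: L1norm_divide)
  also have "\<dots> \<le> 1"
    using L1norm_nonneg[of M f] by (simp add: divide_le_eq_1 add_nonneg_pos del: L1norm_nonneg)
  finally have "L1norm M f + 1 \<in> {k. 0 < k \<and> modular M (\<lambda>x. f x / k) \<le> 1}"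
    by (simp add: add_nonneg_pos)
  then have "0 \<le> luxemburg M f"
    unfolding luxemburg_def by (intro cInf_greatest) auto
  with neg show False by simp
qed

lemma luxemburg_le_L1norm:
  assumes "integrable M f"
  shows "luxemburg M f \<le> L1norm M f"
\<comment> \<open>Working with all \<open>k\<close> above the \<open>L1norm\<close> avoids division
  by 0 for null functions.\<close>
proof (rule dense_ge)
  fix k assume k: "L1norm M f < k"
  then have "0 < k" using L1norm_nonneg[of M f] by linarith
  have "modular M (\<lambda>x. f x / k) \<le> L1norm M f / \<bar>k\<bar>"
    using modular_le_L1norm[of M "\<lambda>x. f x / k"] assms by (simp add: L1norm_divide)
  also have "\<dots> \<le> 1"
    using k \<open>0 < k\<close> by simp
  finally show "luxemburg M f \<le> k"
    using luxemburg_le_iff[OF assms \<open>0 < k\<close>] by simp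
qed

lemma luxemburg_cong_AE:
  assumes "f \<in> borel_measurable M" "g \<in> borel_measurable M" "AE x in M. f x = g x"
  shows "luxemburg M f = luxemburg M g"
proof -
  have "modular M (\<lambda>x. f x / k) = modular M (\<lambda>x. g x / k)" for k
    unfolding modular_def
  proof (rule integral_cong_AE)
    show "AE x in M. phi (f x / k) = phi (g x / k)"
      using assms(3) by eventually_elim simp
  qed (use assms in measurable)
  then show ?thesis by (simp add: luxemburg_def)
qed

lemma luxemburg_mult:
  assumes f: "integrable M f"
  shows "luxemburg M (\<lambda>x. c * f x) = \<bar>c\<bar> * luxemburg M f"
proof -
  have le: "luxemburg M (\<lambda>x. c * f x) \<le> \<bar>c\<bar> * luxemburg M f" if f: "integrable M f" for f and c :: real
  proof (rule dense_ge)
    fix k assume k: "\<bar>c\<bar> * luxemburg M f < k"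
    have "0 < k"
      using k luxemburg_nonneg[OF f] mult_nonneg_nonneg[of "\<bar>c\<bar>"] by (meson abs_ge_zero le_less_trans)
    have "modular M (\<lambda>x. c * f x / k) \<le> 1"
    proof (cases "c = 0")
      case True
      then show ?thesis by (simp add: modular_def)
    next
      case False
      then have "luxemburg M f \<le> k / \<bar>c\<bar>"
        using k by (simp add: field_simps)
      then have "modular M (\<lambda>x. f x / (k / \<bar>c\<bar>)) \<le> 1"
        using luxemburg_le_iff[OF f, of "k / \<bar>c\<bar>"] \<open>0 < k\<close> False by simp
      moreover have "phi (f x / (k / \<bar>c\<bar>)) = phi (c * f x / k)" for x
        by (simp add: phi_def abs_mult abs_divide mult.commute)
      ultimately show ?thesis by (simp add: modular_def)
    qed
    then show "luxemburg M (\<lambda>x. c * f x) \<le> k"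
      using luxemburg_le_iff[of M "\<lambda>x. c * f x" k] f \<open>0 < k\<close> by simp
  qed
  show ?thesis
  proof (cases "c = 0")
    case True
    then show ?thesis
      using le[OF f, of c] luxemburg_nonneg[of M "\<lambda>x. c * f x"] f by simp
  next
    case False
    \<comment> \<open>The reverse inequality is \<open>le\<close> again, applied to
      \<open>c * f\<close> with the factor \<open>inverse c\<close>.\<close>
    have "luxemburg M (\<lambda>x. inverse c * (c * f x)) \<le> \<bar>inverse c\<bar> * luxemburg M (\<lambda>x. c * f x)"
      using f by (intro le) simp
    moreover have "(\<lambda>x. inverse c * (c * f x)) = f"
      using False by auto
    ultimately have "\<bar>c\<bar> * luxemburg M f \<le> luxemburg M (\<lambda>x. c * f x)"
      using False by (simp add: field_simps)
    then show ?thesis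
      using le[OF f, of c] by simp
  qed
qed

lemma luxemburg_triangle:
  assumes f: "integrable M f" and g: "integrable M g"
  shows "luxemburg M (\<lambda>x. f x + g x) \<le> luxemburg M f + luxemburg M g"
proof (rule field_le_epsilon)
  fix e :: real assume "0 < e"
  \<comment> \<open>The slack \<open>e / 2\<close> makes \<open>a\<close> and \<open>b\<close>
    positive, so that \<open>(f + g) / (a + b)\<close> is a convex combination of
    \<open>f / a\<close> and \<open>g / b\<close>.\<close>
  define a b where "a = luxemburg M f + e / 2" and "b = luxemburg M g + e / 2"
  have pos: "0 < a" "0 < b"
    using luxemburg_nonneg[OF f] luxemburg_nonneg[OF g] \<open>0 < e\<close> by (auto simp: a_def b_def)
  have "modular M (\<lambda>x. f x / a) \<le> 1" "modular M (\<lambda>x. g x / b) \<le> 1"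
    using luxemburg_le_iff[OF f pos(1)] luxemburg_le_iff[OF g pos(2)] \<open>0 < e\<close>
    by (auto simp: a_def b_def)
  moreover have "modular M (\<lambda>x. a / (a + b) * (f x / a) + b / (a + b) * (g x / b))
      \<le> a / (a + b) * modular M (\<lambda>x. f x / a) + b / (a + b) * modular M (\<lambda>x. g x / b)"
    using f g pos by (intro modular_convex) (auto simp: add_divide_distrib[symmetric])
  moreover have "(\<lambda>x. a / (a + b) * (f x / a) + b / (a + b) * (g x / b)) = (\<lambda>x. (f x + g x) / (a + b))"
    using pos by (simp add: add_divide_distrib)
  ultimately have "modular M (\<lambda>x. (f x + g x) / (a + b)) \<le> a / (a + b) * 1 + b / (a + b) * 1"
    using pos mult_left_mono[of "modular M (\<lambda>x. f x / a)" 1 "a / (a + b)"]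
      mult_left_mono[of "modular M (\<lambda>x. g x / b)" 1 "b / (a + b)"] by simp
  also have "\<dots> = 1"
    using pos by (simp add: add_divide_distrib[symmetric])
  finally have "luxemburg M (\<lambda>x. f x + g x) \<le> a + b"
    using luxemburg_le_iff[of M "\<lambda>x. f x + g x" "a + b"] f g pos by simp
  then show "luxemburg M (\<lambda>x. f x + g x) \<le> luxemburg M f + luxemburg M g + e"
    by (simp add: a_def b_def)
qed

section \<open>Norm against modular, and equivalence with the \<open>L1norm\<close>\<close>

text \<open>If the modular were below 1, the quadratic scaling bound would leave room to divide
  \<open>f\<close> by some \<open>k < 1\<close> and stay admissible, contradicting the norm being
  1.\<close>

lemma modular_eq_1:
  assumes f: "integrable M f" and "luxemburg M f = 1"
  shows "modular M f = 1"
proof (rule antisym)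
  show "modular M f \<le> 1"
    using luxemburg_le_iff[OF f, of 1] assms by simp
  show "1 \<le> modular M f"
  proof (rule ccontr)
    assume *: "\<not> 1 \<le> modular M f"
    \<comment> \<open>The square root absorbs the factor \<open>1 / k^2\<close>; the 1/2 keeps
      \<open>k\<close> positive if the modular is 0.\<close>
    define k where "k = max (1/2) (sqrt (modular M f))"
    have k: "0 < k" "k < 1"
      using * by (auto simp: k_def)
    have "modular M f \<le> k\<^sup>2"
      by (rule sqrt_le_D) (simp add: k_def)
    have "modular M (\<lambda>x. f x / k) \<le> modular M f / k\<^sup>2"
      using f k by (intro modular_divide_le) auto
    also have "\<dots> \<le> 1"
      using k \<open>modular M f \<le> k\<^sup>2\<close> by simp
    finally have "luxemburg M f \<le> k"
      using luxemburg_le_iff[OF f k(1)] by simp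
    with k assms show False by simp
  qed
qed

text \<open>Normalising \<open>f\<close> to modular 1 costs at most the factor
  \<open>1 / k^2\<close>, where \<open>k\<close> is its norm. This later converts a gap in the
  modular of a midpoint into a gap in its norm.\<close>

lemma luxemburg_square_le_modular:
  assumes f: "integrable M f" and "luxemburg M f \<le> 1"
  shows "(luxemburg M f)\<^sup>2 \<le> modular M f"
proof (cases "luxemburg M f = 0")
  case False
  define k where "k = luxemburg M f"
  have k: "0 < k" "k \<le> 1"
    using False luxemburg_nonneg[OF f] assms by (auto simp: k_def)
  have "luxemburg M (\<lambda>x. f x / k) = 1"
    using luxemburg_mult[OF f, of "1 / k"] k by (simp add: k_def)
  then have "1 = modular M (\<lambda>x. f x / k)"
    using f by (intro modular_eq_1[symmetric]) auto
  also have "\<dots> \<le> modular M f / k\<^sup>2"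
    using f k by (intro modular_divide_le) auto
  finally show ?thesis
    using k by (simp add: k_def[symmetric] field_simps)
qed simp

text \<open>With total mass 1, integrating \<open>phi_ge_half_abs\<close> for \<open>f / k\<close>
  gives \<open>L1norm M f / (2 * k) - 1 / 2 <= 1\<close>, whence the factor 3.\<close>

lemma (in prob_space) L1norm_le_luxemburg:
  assumes f: "integrable M f"
  shows "L1norm M f \<le> 3 * luxemburg M f"
proof -
  have "L1norm M f / 3 \<le> luxemburg M f"
  proof (rule dense_ge)
    fix k assume k: "luxemburg M f < k"
    then have "0 < k" using luxemburg_nonneg[OF f] by linarith
    then have "modular M (\<lambda>x. f x / k) \<le> 1"
      using luxemburg_le_iff[OF f \<open>0 < k\<close>] k by simp
    moreover have "(\<integral>x. \<bar>f x / k\<bar> / 2 - 1 / 2 \<partial>M) \<le> modular M (\<lambda>x. f x / k)"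
      unfolding modular_def using f
      by (intro integral_mono phi_ge_half_abs integrable_phi) auto
    moreover have "(\<integral>x. \<bar>f x / k\<bar> / 2 - 1 / 2 \<partial>M) = L1norm M f / k / 2 - 1 / 2"
      using f \<open>0 < k\<close> by (simp add: L1norm_def prob_space abs_divide)
    ultimately have "L1norm M f / k \<le> 3" by simp
    then show "L1norm M f / 3 \<le> k"
      using \<open>0 < k\<close> by (simp add: field_simps)
  qed
  then show ?thesis by simp
qed

lemma (in prob_space) equiv_L1_norm_luxemburg: "equiv_L1_norm M (luxemburg M)"
  unfolding equiv_L1_norm_def
proof (intro conjI allI impI)
  show "\<exists>a b. 0 < a \<and> 0 < b \<and>
      (\<forall>f. integrable M f \<longrightarrow> a * L1norm M f \<le> luxemburg M f \<and> luxemburg M f \<le> b * L1norm M f)"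
  proof (rule exI[of _ "1/3"], rule exI[of _ 1], intro conjI allI impI)
    fix f :: "'a \<Rightarrow> real" assume "integrable M f"
    then show "1/3 * L1norm M f \<le> luxemburg M f" "luxemburg M f \<le> 1 * L1norm M f"
      using L1norm_le_luxemburg[of f] luxemburg_le_L1norm[of M f] by auto
  qed auto
qed (auto intro: luxemburg_triangle luxemburg_mult luxemburg_cong_AE)

section \<open>Layer cake estimates: from \<open>msq\<close> to \<open>G_X\<close>\<close>

text \<open>Fubini on the region \<open>t <= u < |f x|\<close>: its section over \<open>x\<close>
  has length \<open>|f x| - t\<close>, and \<open>ennreal\<close> sends negative differences to
  0.\<close>

lemma (in prob_space) nn_integral_distfun_tail:
  assumes [measurable]: "f \<in> borel_measurable M"
  shows "(\<integral>\<^sup>+ u. ennreal (distfun M f u) * indicator {t..} u \<partial>lborel) = (\<integral>\<^sup>+ x. ennreal (\<bar>f x\<bar> - t) \<partial>M)"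
proof -
  interpret pair_sigma_finite lborel M
    by (intro pair_sigma_finite.intro sigma_finite_lborel sigma_finite_measure_axioms)
  have "ennreal (distfun M f u) * indicator {t..} u
      = (\<integral>\<^sup>+ x. (if t \<le> u \<and> u < \<bar>f x\<bar> then 1 else 0) \<partial>M)" for u
  proof -
    have "ennreal (distfun M f u) = emeasure M {x \<in> space M. u < \<bar>f x\<bar>}"
      by (simp add: distfun_def emeasure_eq_measure)
    also have "\<dots> = (\<integral>\<^sup>+ x. indicator {x \<in> space M. u < \<bar>f x\<bar>} x \<partial>M)"
      by simp
    finally have "ennreal (distfun M f u) * indicator {t..} u
        = (\<integral>\<^sup>+ x. indicator {x \<in> space M. u < \<bar>f x\<bar>} x * indicator {t..} u \<partial>M)"
      by (subst nn_integral_multc) auto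
    also have "\<dots> = (\<integral>\<^sup>+ x. (if t \<le> u \<and> u < \<bar>f x\<bar> then 1 else 0) \<partial>M)"
      by (intro nn_integral_cong) (auto simp: indicator_def)
    finally show ?thesis .
  qed
  then have "(\<integral>\<^sup>+ u. ennreal (distfun M f u) * indicator {t..} u \<partial>lborel)
      = (\<integral>\<^sup>+ u. (\<integral>\<^sup>+ x. (if t \<le> u \<and> u < \<bar>f x\<bar> then 1 else 0) \<partial>M) \<partial>lborel)"
    by simp
  also have "\<dots> = (\<integral>\<^sup>+ x. (\<integral>\<^sup>+ u. (if t \<le> u \<and> u < \<bar>f x\<bar> then 1 else 0) \<partial>lborel) \<partial>M)"
    by (rule Fubini'[symmetric]) measurable
  also have "\<dots> = (\<integral>\<^sup>+ x. ennreal (\<bar>f x\<bar> - t) \<partial>M)"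
  proof (rule nn_integral_cong)
    fix x
    have "(\<integral>\<^sup>+ u. (if t \<le> u \<and> u < \<bar>f x\<bar> then 1 else 0) \<partial>lborel)
        = (\<integral>\<^sup>+ u. indicator {t..<\<bar>f x\<bar>} u \<partial>lborel)"
      by (intro nn_integral_cong) (auto simp: indicator_def)
    also have "\<dots> = ennreal (\<bar>f x\<bar> - t)"
      by (cases "t \<le> \<bar>f x\<bar>") (auto simp: ennreal_neg)
    finally show "(\<integral>\<^sup>+ u. (if t \<le> u \<and> u < \<bar>f x\<bar> then 1 else 0) \<partial>lborel) = ennreal (\<bar>f x\<bar> - t)" .
  qed
  finally show ?thesis .
qed

text \<open>Only \<open>t\<close> in \<open>[0, r]\<close> is kept, with \<open>r\<close> half the
  smaller of \<open>|s|\<close> and \<open>1 / \<tau>\<close>. There the integrand is at least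
  \<open>|s| / 2\<close>, and \<open>4 * \<tau>^2\<close> times \<open>|s| / 2 * r\<close> is
  exactly \<open>msq (\<tau> * s)\<close>.\<close>

lemma msq_le_nn_integral:
  assumes "0 < \<tau>"
  shows "ennreal (msq (\<tau> * s))
    \<le> ennreal (4 * \<tau>\<^sup>2) * (\<integral>\<^sup>+ t. ennreal (\<bar>s\<bar> - t) * indicator {0..1/\<tau>} t \<partial>lborel)"
proof -
  define r where "r = min \<bar>s\<bar> (1/\<tau>) / 2"
  have r: "0 \<le> r" "r \<le> \<bar>s\<bar> / 2" "r \<le> 1/\<tau>"
    using assms min.cobounded2[of "\<bar>s\<bar>" "1/\<tau>"] zero_less_divide_1_iff[of \<tau>]
    unfolding r_def by (auto, linarith)
  have "4 * \<tau>\<^sup>2 * (\<bar>s\<bar> / 2 * r) = \<tau>\<^sup>2 * \<bar>s\<bar> * min \<bar>s\<bar> (1/\<tau>)"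
    by (simp add: r_def)
  also have "\<dots> = min (\<tau>\<^sup>2 * \<bar>s\<bar> * \<bar>s\<bar>) (\<tau>\<^sup>2 * \<bar>s\<bar> * (1/\<tau>))"
    by (simp add: min_mult_distrib_left)
  also have "\<dots> = msq (\<tau> * s)"
    using assms by (simp add: msq_def power2_eq_square abs_mult mult_ac)
  finally have "ennreal (msq (\<tau> * s)) = ennreal (4 * \<tau>\<^sup>2) * (ennreal (\<bar>s\<bar> / 2) * ennreal r)"
    using r by (simp add: ennreal_mult[symmetric])
  also have "ennreal (\<bar>s\<bar> / 2) * ennreal r = (\<integral>\<^sup>+ t. ennreal (\<bar>s\<bar> / 2) * indicator {0..r} t \<partial>lborel)"
    using r by (subst nn_integral_cmult_indicator) auto
  also have "\<dots> \<le> (\<integral>\<^sup>+ t. ennreal (\<bar>s\<bar> - t) * indicator {0..1/\<tau>} t \<partial>lborel)"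
    using r by (intro nn_integral_mono) (auto simp: indicator_def intro!: ennreal_leI)
  finally show ?thesis
    by (simp add: mult_left_mono)
qed

lemma (in prob_space) integral_msq_le_distfun:
  assumes f: "integrable M f" and "0 < \<tau>"
  shows "ennreal (\<integral>x. msq (\<tau> * f x) \<partial>M) \<le> ennreal (4 * \<tau>\<^sup>2) *
    (\<integral>\<^sup>+ t. (\<integral>\<^sup>+ u. ennreal (distfun M f u) * indicator {t..} u \<partial>lborel) * indicator {0..1/\<tau>} t \<partial>lborel)"
proof -
  interpret pair_sigma_finite lborel M
    by (intro pair_sigma_finite.intro sigma_finite_lborel sigma_finite_measure_axioms)
  have [measurable]: "f \<in> borel_measurable M"
    using f by simp
  have "ennreal (\<integral>x. msq (\<tau> * f x) \<partial>M) = (\<integral>\<^sup>+ x. ennreal (msq (\<tau> * f x)) \<partial>M)"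
    using f by (intro nn_integral_eq_integral[symmetric] integrable_msq) auto
  also have "\<dots> \<le> (\<integral>\<^sup>+ x. ennreal (4 * \<tau>\<^sup>2) *
      (\<integral>\<^sup>+ t. ennreal (\<bar>f x\<bar> - t) * indicator {0..1/\<tau>} t \<partial>lborel) \<partial>M)"
    using assms by (intro nn_integral_mono msq_le_nn_integral)
  also have "\<dots> = ennreal (4 * \<tau>\<^sup>2) *
      (\<integral>\<^sup>+ x. (\<integral>\<^sup>+ t. ennreal (\<bar>f x\<bar> - t) * indicator {0..1/\<tau>} t \<partial>lborel) \<partial>M)"
    by (intro nn_integral_cmult) measurable
  also have "(\<integral>\<^sup>+ x. (\<integral>\<^sup>+ t. ennreal (\<bar>f x\<bar> - t) * indicator {0..1/\<tau>} t \<partial>lborel) \<partial>M)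
      = (\<integral>\<^sup>+ t. (\<integral>\<^sup>+ x. ennreal (\<bar>f x\<bar> - t) * indicator {0..1/\<tau>} t \<partial>M) \<partial>lborel)"
    by (rule Fubini') measurable
  also have "\<dots> = (\<integral>\<^sup>+ t. (\<integral>\<^sup>+ x. ennreal (\<bar>f x\<bar> - t) \<partial>M) * indicator {0..1/\<tau>} t \<partial>lborel)"
    by (intro nn_integral_cong nn_integral_multc) measurable
  finally show ?thesis
    by (simp add: nn_integral_distfun_tail)
qed

text \<open>\<open>G_X\<close> is normalised in the \<open>L1norm\<close>, so \<open>f\<close> is
  divided by its \<open>L1norm\<close> \<open>L\<close>, which lies between 1 and 3. Undoing this
  costs \<open>L^2 <= 9\<close>, and 36 is 9 times the 4 of the layer cake bound.\<close>

lemma (in prob_space) integral_msq_le_G_X: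
  assumes X: "closed_L1_subspace M X" and f: "f \<in> X" "luxemburg M f = 1" and "0 < \<tau>"
  shows "ennreal (\<integral>x. msq (\<tau> * f x) \<partial>M)
    \<le> ennreal (36 * \<tau>\<^sup>2) * (\<integral>\<^sup>+ t. G_X M X t * indicator {0..1/\<tau>} t \<partial>lborel)"
proof -
  define L where "L = L1norm M f"
  have int: "integrable M f"
    using X f by (auto simp: closed_L1_subspace_def)
  have L: "1 \<le> L" "L \<le> 3"
    using luxemburg_le_L1norm[OF int] L1norm_le_luxemburg[OF int] f by (auto simp: L_def)
  define g where "g = (\<lambda>x. 1 / L * f x)"
  have g: "g \<in> X" "L1norm M g = 1" "integrable M g"
    using X f L int unfolding g_def L1norm_mult closed_L1_subspace_def by (blast, auto simp: L_def)
  have "(\<integral>x. msq (\<tau> * f x) \<partial>M) \<le> (\<integral>x. 9 * msq (\<tau> * g x) \<partial>M)"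
  proof (rule integral_mono)
    show "msq (\<tau> * f x) \<le> 9 * msq (\<tau> * g x)" for x
    proof -
      have eq: "\<tau> * f x = L * (\<tau> * g x)"
        using L by (simp add: g_def)
      have "msq (\<tau> * f x) \<le> L\<^sup>2 * msq (\<tau> * g x)"
        unfolding eq using L(1) by (rule msq_scale_le)
      also have "\<dots> \<le> 3\<^sup>2 * msq (\<tau> * g x)"
        using L by (intro mult_right_mono power_mono) auto
      finally show ?thesis by simp
    qed
  qed (use int g in \<open>auto intro!: integrable_msq\<close>)
  also have "\<dots> = 9 * (\<integral>x. msq (\<tau> * g x) \<partial>M)"
    by simp
  finally have "ennreal (\<integral>x. msq (\<tau> * f x) \<partial>M) \<le> ennreal (9 * (\<integral>x. msq (\<tau> * g x) \<partial>M))"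
    by (rule ennreal_leI)
  also have "\<dots> = ennreal 9 * ennreal (\<integral>x. msq (\<tau> * g x) \<partial>M)"
    by (rule ennreal_mult) auto
  also have "\<dots> \<le> ennreal 9 * (ennreal (4 * \<tau>\<^sup>2) * (\<integral>\<^sup>+ t. G_X M X t * indicator {0..1/\<tau>} t \<partial>lborel))"
  proof (rule mult_left_mono)
    have "ennreal (\<integral>x. msq (\<tau> * g x) \<partial>M) \<le> ennreal (4 * \<tau>\<^sup>2) *
        (\<integral>\<^sup>+ t. (\<integral>\<^sup>+ u. ennreal (distfun M g u) * indicator {t..} u \<partial>lborel) * indicator {0..1/\<tau>} t \<partial>lborel)"
      using g \<open>0 < \<tau>\<close> by (intro integral_msq_le_distfun)
    also have "\<dots> \<le> ennreal (4 * \<tau>\<^sup>2) * (\<integral>\<^sup>+ t. G_X M X t * indicator {0..1/\<tau>} t \<partial>lborel)"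
      unfolding G_X_def using g by (intro mult_left_mono nn_integral_mono mult_right_mono Sup_upper) auto
    finally show "ennreal (\<integral>x. msq (\<tau> * g x) \<partial>M)
        \<le> ennreal (4 * \<tau>\<^sup>2) * (\<integral>\<^sup>+ t. G_X M X t * indicator {0..1/\<tau>} t \<partial>lborel)" .
  qed simp
  also have "\<dots> = ennreal (36 * \<tau>\<^sup>2) * (\<integral>\<^sup>+ t. G_X M X t * indicator {0..1/\<tau>} t \<partial>lborel)"
    by (simp add: mult.assoc[symmetric] ennreal_mult[symmetric] del: ennreal_numeral)
  finally show ?thesis .
qed

section \<open>Smoothness of the Luxemburg norm\<close>

text \<open>A reverse Jensen inequality: expanding at the mean \<open>w\<close>, the linear terms
  add up to \<open>D * (u * x + v * y - w) = 0\<close>.\<close>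

lemma phi_taylor_convex:
  assumes "0 \<le> u" "0 \<le> v" "u + v = 1" and w: "w = u * x + v * y"
  shows "u * phi x + v * phi y \<le> phi w + 2 * (u * msq (x - w) + v * msq (y - w))"
proof -
  define D where "D = w / (1 + \<bar>w\<bar>)"
  have "phi x \<le> phi w + D * (x - w) + 2 * msq (x - w)" "phi y \<le> phi w + D * (y - w) + 2 * msq (y - w)"
    using phi_taylor[of w "x - w"] phi_taylor[of w "y - w"] by (auto simp: D_def)
  then have "u * phi x + v * phi y
      \<le> u * (phi w + D * (x - w) + 2 * msq (x - w)) + v * (phi w + D * (y - w) + 2 * msq (y - w))"
    using assms by (intro add_mono mult_left_mono)
  also have "\<dots> = (u + v) * phi w + D * (u * x + v * y - (u + v) * w)
      + 2 * (u * msq (x - w) + v * msq (y - w))"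
    by (simp add: algebra_simps)
  finally show ?thesis
    using assms by simp
qed

text \<open>The normalised vectors \<open>p\<close> and \<open>q\<close> have modular 1, while their
  weighted mean \<open>w = f / \<rho>\<close> has modular at most \<open>1 / \<rho>\<close>. The
  reverse Jensen inequality therefore gives \<open>1 <= 1 / \<rho> + 32 * E\<close>, which bounds
  \<open>\<rho> - 1\<close>.\<close>

lemma (in prob_space) luxemburg_smoothness:
  assumes f: "integrable M f" "luxemburg M f = 1" and g: "integrable M g" "luxemburg M g = 1"
    and \<tau>: "0 < \<tau>" "\<tau> \<le> 1/2"
  shows "(luxemburg M (\<lambda>x. f x + \<tau> * g x) + luxemburg M (\<lambda>x. f x - \<tau> * g x)) / 2 - 1
    \<le> 48 * ((\<integral>x. msq (\<tau> * f x) \<partial>M) + (\<integral>x. msq (\<tau> * g x) \<partial>M))"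
proof -
  define a b where "a = luxemburg M (\<lambda>x. f x + \<tau> * g x)" and "b = luxemburg M (\<lambda>x. f x - \<tau> * g x)"
  define E where "E = (\<integral>x. msq (\<tau> * f x) \<partial>M) + (\<integral>x. msq (\<tau> * g x) \<partial>M)"
  define \<rho> where "\<rho> = (a + b) / 2"
  have uv: "integrable M (\<lambda>x. f x + \<tau> * g x)" "integrable M (\<lambda>x. f x - \<tau> * g x)"
    using f g by auto
  have scaled: "luxemburg M (\<lambda>x. c * f x) = \<bar>c\<bar>" "luxemburg M (\<lambda>x. c * g x) = \<bar>c\<bar>" for c
    using luxemburg_mult[OF f(1), of c] luxemburg_mult[OF g(1), of c] f g by auto
  have "a \<le> 1 + \<tau>"
    using luxemburg_triangle[of M f "\<lambda>x. \<tau> * g x"] f g \<tau> by (simp add: scaled a_def)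
  have "b \<le> 1 + \<tau>"
    using luxemburg_triangle[of M f "\<lambda>x. - \<tau> * g x"] f g \<tau> scaled(2)[of "- \<tau>"] by (simp add: b_def)
  have "2 \<le> a + b"
    using luxemburg_triangle[OF uv] scaled(1)[of 2] by (simp add: a_def b_def)
  \<comment> \<open>The sum is at least 2 and each summand is at most 3/2.\<close>
  then have ab: "1/2 \<le> a" "1/2 \<le> b"
    using \<open>a \<le> 1 + \<tau>\<close> \<open>b \<le> 1 + \<tau>\<close> \<tau> by auto
  have "a \<le> b + 2 * \<tau>"
    using luxemburg_triangle[OF uv(2), of "\<lambda>x. 2 * \<tau> * g x"] g \<tau> scaled(2)[of "2 * \<tau>"]
    by (simp add: a_def b_def algebra_simps)
  have "b \<le> a + 2 * \<tau>"
    using luxemburg_triangle[OF uv(1), of "\<lambda>x. - 2 * \<tau> * g x"] g \<tau> scaled(2)[of "- 2 * \<tau>"]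
    by (simp add: a_def b_def algebra_simps)
  have prod: "1 \<le> a * (a + b)" "1 \<le> b * (a + b)"
    using mult_mono[of "1/2" a 2 "a + b"] mult_mono[of "1/2" b 2 "a + b"] ab \<open>2 \<le> a + b\<close> by auto
  have nz: "a \<noteq> 0" "b \<noteq> 0" "a + b \<noteq> 0"
    using ab by auto
  define w where "w = (\<lambda>x. 1 / \<rho> * f x)"
  define p q where "p = (\<lambda>x. (f x + \<tau> * g x) / a)" and "q = (\<lambda>x. (f x - \<tau> * g x) / b)"
  \<comment> \<open>The 16 is 4 for splitting the sum times 4 for the factor 2 in the coefficient
    bounds.\<close>
  have dist_w: "msq (z - w x) \<le> 16 * (msq (\<tau> * f x) + msq (\<tau> * g x))"
    if z: "z - w x = \<kappa> * f x + \<nu> * g x" and "\<bar>\<kappa>\<bar> \<le> 2 * \<tau>" "\<bar>\<nu>\<bar> \<le> 2 * \<tau>" for z x \<kappa> \<nu>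
  proof -
    have "msq (\<kappa> * f x) \<le> msq (2 * (\<tau> * f x))" "msq (\<nu> * g x) \<le> msq (2 * (\<tau> * g x))"
      using that \<tau> mult_right_mono[of "\<bar>\<kappa>\<bar>" "2 * \<tau>" "\<bar>f x\<bar>"] mult_right_mono[of "\<bar>\<nu>\<bar>" "2 * \<tau>" "\<bar>g x\<bar>"]
      by (auto intro!: msq_mono simp: abs_mult mult.assoc)
    then show ?thesis
      using msq_add_le[of "\<kappa> * f x" "\<nu> * g x"] msq_scale_le[of 2 "\<tau> * f x"] msq_scale_le[of 2 "\<tau> * g x"]
      by (simp add: z)
  qed
  have bound: "msq (p x - w x) \<le> 16 * (msq (\<tau> * f x) + msq (\<tau> * g x))"
    "msq (q x - w x) \<le> 16 * (msq (\<tau> * f x) + msq (\<tau> * g x))" for x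
  proof -
    \<comment> \<open>For \<open>c = a\<close> and \<open>s = a + b\<close> the coefficient of
      \<open>f\<close> has numerator \<open>b - a\<close>, at most \<open>2 * \<tau>\<close> in
      absolute value by the triangle inequality, over a denominator that \<open>prod\<close> bounds
      below by 1.\<close>
    have split: "(y + z) / c - 2 / s * y = (s - 2 * c) / (c * s) * y + z / c"
      if "c \<noteq> 0" "s \<noteq> 0" for y z c s :: real
      using that by (simp add: field_simps)
    have le: "\<bar>d / c\<bar> \<le> 2 * \<tau>" if "1 \<le> c" "\<bar>d\<bar> \<le> 2 * \<tau>" for c d :: real
      using that \<tau> mult_mono[of 1 c "\<bar>d\<bar>" "2 * \<tau>"] by (simp add: abs_divide divide_le_eq mult.commute)
    show "msq (p x - w x) \<le> 16 * (msq (\<tau> * f x) + msq (\<tau> * g x))"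
    proof (rule dist_w)
      show "p x - w x = (b - a) / (a * (a + b)) * f x + \<tau> / a * g x"
        using split[of a "a + b" "f x" "\<tau> * g x"] nz by (simp add: p_def w_def \<rho>_def)
      show "\<bar>(b - a) / (a * (a + b))\<bar> \<le> 2 * \<tau>"
        using \<open>a \<le> b + 2 * \<tau>\<close> \<open>b \<le> a + 2 * \<tau>\<close> by (intro le prod) auto
      show "\<bar>\<tau> / a\<bar> \<le> 2 * \<tau>"
        using ab \<tau> mult_left_mono[of "1/2" a "2 * \<tau>"] by (simp add: abs_divide divide_le_eq)
    qed
    show "msq (q x - w x) \<le> 16 * (msq (\<tau> * f x) + msq (\<tau> * g x))"
    proof (rule dist_w)
      show "q x - w x = (a - b) / (b * (a + b)) * f x + (- \<tau> / b) * g x"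
        using split[of b "a + b" "f x" "- \<tau> * g x"] nz by (simp add: q_def w_def \<rho>_def)
      show "\<bar>(a - b) / (b * (a + b))\<bar> \<le> 2 * \<tau>"
        using \<open>a \<le> b + 2 * \<tau>\<close> \<open>b \<le> a + 2 * \<tau>\<close> by (intro le prod) auto
      show "\<bar>- \<tau> / b\<bar> \<le> 2 * \<tau>"
        using ab \<tau> mult_left_mono[of "1/2" b "2 * \<tau>"] by (simp add: abs_divide divide_le_eq)
    qed
  qed
  define \<alpha> \<beta> where "\<alpha> = a / (a + b)" and "\<beta> = b / (a + b)"
  have \<alpha>\<beta>: "0 \<le> \<alpha>" "0 \<le> \<beta>" "\<alpha> + \<beta> = 1"
    using ab by (auto simp: \<alpha>_def \<beta>_def add_divide_distrib[symmetric])
  have "\<alpha> * phi (p x) + \<beta> * phi (q x) \<le> phi (w x) + 32 * (msq (\<tau> * f x) + msq (\<tau> * g x))" for x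
  proof -
    have "w x = \<alpha> * p x + \<beta> * q x"
      using ab by (simp add: w_def p_def q_def \<alpha>_def \<beta>_def \<rho>_def add_divide_distrib[symmetric])
    then have "\<alpha> * phi (p x) + \<beta> * phi (q x)
        \<le> phi (w x) + 2 * (\<alpha> * msq (p x - w x) + \<beta> * msq (q x - w x))"
      using \<alpha>\<beta> by (intro phi_taylor_convex)
    also have "\<alpha> * msq (p x - w x) + \<beta> * msq (q x - w x) \<le> 16 * (msq (\<tau> * f x) + msq (\<tau> * g x))"
      using \<alpha>\<beta> bound by (intro convex_bound_le)
    finally show ?thesis by simp
  qed
  moreover have int: "integrable M (\<lambda>x. phi (p x))" "integrable M (\<lambda>x. phi (q x))"
    "integrable M (\<lambda>x. phi (w x))"
    by (rule integrable_phi; use f g in \<open>simp add: p_def q_def w_def\<close>)+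
  moreover have int': "integrable M (\<lambda>x. msq (\<tau> * f x))" "integrable M (\<lambda>x. msq (\<tau> * g x))"
    by (rule integrable_msq; use f g in simp)+
  ultimately have "(\<integral>x. \<alpha> * phi (p x) + \<beta> * phi (q x) \<partial>M)
      \<le> (\<integral>x. phi (w x) + 32 * (msq (\<tau> * f x) + msq (\<tau> * g x)) \<partial>M)"
    by (intro integral_mono) auto
  moreover have "(\<integral>x. \<alpha> * phi (p x) + \<beta> * phi (q x) \<partial>M) = \<alpha> * modular M p + \<beta> * modular M q"
    using int by (simp add: modular_def)
  moreover have "(\<integral>x. phi (w x) + 32 * (msq (\<tau> * f x) + msq (\<tau> * g x)) \<partial>M) = modular M w + 32 * E"
    using int int' by (simp add: modular_def E_def)
  moreover have "modular M p = 1"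
    using luxemburg_mult[OF uv(1), of "1 / a"] uv(1) ab
    by (intro modular_eq_1) (auto simp: p_def a_def[symmetric])
  moreover have "modular M q = 1"
    using luxemburg_mult[OF uv(2), of "1 / b"] uv(2) ab
    by (intro modular_eq_1) (auto simp: q_def b_def[symmetric])
  moreover have "modular M w \<le> 1 / \<rho> * modular M f"
    unfolding w_def using f \<open>2 \<le> a + b\<close> by (intro modular_contract) (auto simp: \<rho>_def)
  moreover have "modular M f = 1"
    using f by (intro modular_eq_1)
  ultimately have "1 \<le> 1 / \<rho> + 32 * E"
    using \<alpha>\<beta> by simp
  have \<rho>: "1 \<le> \<rho>" "\<rho> \<le> 3/2"
    using \<open>2 \<le> a + b\<close> \<open>a \<le> 1 + \<tau>\<close> \<open>b \<le> 1 + \<tau>\<close> \<tau> by (auto simp: \<rho>_def)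
  have "0 \<le> E"
    by (simp add: E_def)
  \<comment> \<open>Clearing the denominator costs a factor \<open>\<rho> <= 3/2\<close>, which
    turns 32 into 48.\<close>
  have "\<rho> * 1 \<le> \<rho> * (1 / \<rho> + 32 * E)"
    using \<open>1 \<le> 1 / \<rho> + 32 * E\<close> \<rho> by (intro mult_left_mono) auto
  then have "\<rho> - 1 \<le> 32 * (\<rho> * E)"
    using \<rho> by (simp add: algebra_simps)
  also have "\<dots> \<le> 32 * (3/2 * E)"
    using \<rho> \<open>0 \<le> E\<close> by (intro mult_left_mono mult_right_mono) auto
  finally have "\<rho> - 1 \<le> 48 * E"
    by simp
  then show ?thesis
    by (simp only: \<rho>_def E_def a_def b_def)
qed

text \<open>The triangle inequality already bounds the left side by \<open>\<tau>\<close>. As the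
  \<open>L1norm\<close> of \<open>f\<close> is at least 1, \<open>msq_ge\<close> makes the right
  side at least \<open>2 * \<tau> - 1/2\<close>, which is enough from \<open>\<tau> = 1/2\<close>
  on.\<close>

lemma (in prob_space) luxemburg_smoothness_large:
  assumes f: "integrable M f" "luxemburg M f = 1" and g: "integrable M g" "luxemburg M g = 1"
    and \<tau>: "1/2 \<le> \<tau>"
  shows "(luxemburg M (\<lambda>x. f x + \<tau> * g x) + luxemburg M (\<lambda>x. f x - \<tau> * g x)) / 2 - 1
    \<le> 8 * (\<integral>x. msq (\<tau> * f x) \<partial>M)"
proof -
  have "luxemburg M (\<lambda>x. f x + c * g x) \<le> 1 + \<bar>c\<bar>" for c
    using luxemburg_triangle[of M f "\<lambda>x. c * g x"] luxemburg_mult[OF g(1), of c] f g by simp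
  from this[of \<tau>] this[of "- \<tau>"]
  have "(luxemburg M (\<lambda>x. f x + \<tau> * g x) + luxemburg M (\<lambda>x. f x - \<tau> * g x)) / 2 - 1 \<le> \<tau>"
    using \<tau> by (simp add: field_simps)
  moreover have "(\<integral>x. \<bar>\<tau> * f x\<bar> / 4 - 1 / 16 \<partial>M) \<le> (\<integral>x. msq (\<tau> * f x) \<partial>M)"
    using f by (intro integral_mono msq_ge integrable_msq) auto
  moreover have "(\<integral>x. \<bar>\<tau> * f x\<bar> / 4 - 1 / 16 \<partial>M) = \<tau> * L1norm M f / 4 - 1 / 16"
    using f \<tau> by (simp add: L1norm_def prob_space abs_mult)
  moreover have "\<tau> * 1 \<le> \<tau> * L1norm M f"
    using luxemburg_le_L1norm[OF f(1)] f \<tau> by (intro mult_left_mono) auto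
  ultimately show ?thesis
    using \<tau> by linarith
qed

section \<open>Convexity of the Luxemburg norm\<close>

lemma (in prob_space) distfun_Markov:
  assumes "integrable M f" "0 < a"
  shows "distfun M f a \<le> L1norm M f / a"
proof -
  have "distfun M f a \<le> measure M {x \<in> space M. a \<le> \<bar>f x\<bar>}"
    unfolding distfun_def using assms by (intro finite_measure_mono) auto
  also have "\<dots> \<le> L1norm M f / a"
    unfolding L1norm_def using assms by (intro integral_Markov_inequality_measure[of M _ "space M"]) auto
  finally show ?thesis .
qed

text \<open>The pointwise gap of \<open>phi\<close> is integrated over \<open>S\<close>; off
  \<open>S\<close> it is nonnegative by convexity. Since \<open>f\<close> and \<open>g\<close> have
  modular 1, this bounds 1 minus the modular of the midpoint, and
  \<open>luxemburg_square_le_modular\<close> passes to the norm.\<close>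

lemma (in prob_space) luxemburg_convexity:
  assumes f: "integrable M f" "luxemburg M f = 1" and g: "integrable M g" "luxemburg M g = 1"
    and s: "0 \<le> s" and c: "0 \<le> c" "c \<le> distfun M (\<lambda>x. f x - g x) s"
  shows "s\<^sup>2 * c ^ 3 / 5408 \<le> 1 - luxemburg M (\<lambda>x. (f x + g x) / 2)"
\<comment> \<open>The cut-off \<open>12 / c\<close> needs \<open>c > 0\<close>; for
  \<open>c = 0\<close> the claim is the triangle inequality.\<close>
proof (cases "c = 0")
  case True
  have "luxemburg M (\<lambda>x. (1/2) * (f x + g x)) = (1/2) * luxemburg M (\<lambda>x. f x + g x)"
    using f g by (subst luxemburg_mult) auto
  then show ?thesis
    using True luxemburg_triangle[OF f(1) g(1)] f g by simp
next
  case False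
  define N where "N = luxemburg M (\<lambda>x. (f x + g x) / 2)"
  \<comment> \<open>Unit vectors have \<open>L1norm\<close> at most 3, so Markov bounds each of the
    two tails by \<open>3 / a = c / 4\<close>, and half of \<open>c\<close> survives in
    \<open>S\<close>.\<close>
  define a where "a = 12 / c"
  have "c > 0"
    using False c by simp
  have "c \<le> 1"
    using c prob_le_1 unfolding distfun_def by (meson order_trans)
  have "a > 0"
    using \<open>c > 0\<close> by (simp add: a_def)
  have [measurable]: "f \<in> borel_measurable M" "g \<in> borel_measurable M"
    using f g by auto
  have tail: "distfun M h a \<le> c / 4" if h: "integrable M h" "luxemburg M h = 1" for h
  proof -
    have "distfun M h a \<le> L1norm M h / a"
      using h \<open>a > 0\<close> by (intro distfun_Markov)
    also have "\<dots> \<le> 3 / a"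
      using L1norm_le_luxemburg[OF h(1)] h \<open>a > 0\<close> by (intro divide_right_mono) auto
    finally show ?thesis
      by (simp add: a_def)
  qed
  define S where "S = {x \<in> space M. s < \<bar>f x - g x\<bar> \<and> \<bar>f x\<bar> \<le> a \<and> \<bar>g x\<bar> \<le> a}"
  have [measurable]: "S \<in> sets M"
    unfolding S_def by measurable
  have "c \<le> measure M {x \<in> space M. s < \<bar>f x - g x\<bar>}"
    using c by (simp add: distfun_def)
  also have "\<dots> \<le> measure M (S \<union> ({x \<in> space M. a < \<bar>f x\<bar>} \<union> {x \<in> space M. a < \<bar>g x\<bar>}))"
    by (intro finite_measure_mono) (auto simp: S_def)
  also have "\<dots> \<le> measure M S + measure M ({x \<in> space M. a < \<bar>f x\<bar>} \<union> {x \<in> space M. a < \<bar>g x\<bar>})"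
    by (intro measure_Un_le) auto
  also have "\<dots> \<le> measure M S + (measure M {x \<in> space M. a < \<bar>f x\<bar>} + measure M {x \<in> space M. a < \<bar>g x\<bar>})"
    by (intro add_left_mono measure_Un_le) auto
  also have "\<dots> \<le> measure M S + (c / 4 + c / 4)"
    using tail[OF f] tail[OF g] by (intro add_left_mono add_mono) (auto simp: distfun_def)
  finally have S: "c / 2 \<le> measure M S"
    by simp
  have int: "integrable M (\<lambda>x. phi (f x))" "integrable M (\<lambda>x. phi (g x))"
    "integrable M (\<lambda>x. phi ((f x + g x) / 2))"
    by (rule integrable_phi; use f g in simp)+
  define \<kappa> where "\<kappa> = s\<^sup>2 / (8 * (1 + a)\<^sup>2)"
  have "\<kappa> * measure M S = (\<integral>x. \<kappa> * indicator S x \<partial>M)"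
    by simp
  also have "\<dots> \<le> (\<integral>x. (phi (f x) + phi (g x)) / 2 - phi ((f x + g x) / 2) \<partial>M)"
  proof (rule integral_mono)
    fix x
    show "\<kappa> * indicator S x \<le> (phi (f x) + phi (g x)) / 2 - phi ((f x + g x) / 2)"
    proof (cases "x \<in> S")
      case True
      have "s\<^sup>2 \<le> \<bar>f x - g x\<bar>\<^sup>2"
        using True s by (intro power_mono) (auto simp: S_def)
      then have "\<kappa> \<le> (f x - g x)\<^sup>2 / (8 * (1 + a)\<^sup>2)"
        unfolding \<kappa>_def by (intro divide_right_mono) auto
      also have "\<dots> \<le> (phi (f x) + phi (g x)) / 2 - phi ((f x + g x) / 2)"
        using True by (intro phi_convexity_gap) (auto simp: S_def)
      finally show ?thesis
        using True by simp
    next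
      case False
      then show ?thesis
        using phi_convex[of "1/2" "1/2" "f x" "g x"] by (simp add: add_divide_distrib)
    qed
  next
    show "integrable M (\<lambda>x. (phi (f x) + phi (g x)) / 2 - phi ((f x + g x) / 2))"
      using int by auto
  qed (simp add: emeasure_eq_measure)
  also have "\<dots> = (modular M f + modular M g) / 2 - modular M (\<lambda>x. (f x + g x) / 2)"
    using int by (simp add: modular_def)
  also have "\<dots> = 1 - modular M (\<lambda>x. (f x + g x) / 2)"
    using modular_eq_1[OF f] modular_eq_1[OF g] by simp
  also have "\<dots> \<le> 1 - N\<^sup>2"
  proof -
    have "modular M (\<lambda>x. (f x + g x) / 2) \<ge> N\<^sup>2"
      unfolding N_def
    proof (rule luxemburg_square_le_modular)
      have "luxemburg M (\<lambda>x. (1/2) * (f x + g x)) = (1/2) * luxemburg M (\<lambda>x. f x + g x)"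
        using f g by (subst luxemburg_mult) auto
      then show "luxemburg M (\<lambda>x. (f x + g x) / 2) \<le> 1"
        using luxemburg_triangle[OF f(1) g(1)] f g by simp
    qed (use f g in auto)
    then show ?thesis by simp
  qed
  also have "\<dots> \<le> 2 * (1 - N)"
    using zero_le_power2[of "N - 1"] by (simp add: power2_diff)
  finally have gap: "\<kappa> * measure M S / 2 \<le> 1 - N"
    by simp
  \<comment> \<open>This uses \<open>c <= 1\<close>. The final constant is
    \<open>5408 = 8 * 13^2 * 2 * 2\<close>, the last two factors coming from \<open>c / 2\<close>
    and from \<open>1 - N^2 <= 2 * (1 - N)\<close>.\<close>
  have "1 + a \<le> 13 / c"
    using \<open>c > 0\<close> \<open>c \<le> 1\<close> by (simp add: a_def field_simps)
  then have "(1 + a)\<^sup>2 \<le> (13 / c)\<^sup>2"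
    using \<open>a > 0\<close> by (intro power_mono) auto
  then have "s\<^sup>2 / (8 * (13 / c)\<^sup>2) \<le> \<kappa>"
    unfolding \<kappa>_def using \<open>a > 0\<close> \<open>c > 0\<close> by (intro divide_left_mono mult_left_mono) auto
  then have "s\<^sup>2 / (8 * (13 / c)\<^sup>2) * (c / 2) / 2 \<le> \<kappa> * measure M S / 2"
    using S \<open>c > 0\<close> by (intro divide_right_mono mult_mono) (auto simp: \<kappa>_def)
  moreover have "s\<^sup>2 / (8 * (13 / c)\<^sup>2) * (c / 2) / 2 = s\<^sup>2 * c ^ 3 / 5408"
    using \<open>c > 0\<close> by (simp add: field_simps power2_eq_square power3_eq_cube)
  ultimately have "s\<^sup>2 * c ^ 3 / 5408 \<le> \<kappa> * measure M S / 2"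
    by (simp only:)
  then show ?thesis
    using gap unfolding N_def by (rule order_trans)
qed

section \<open>Subspaces: the bounds in terms of \<open>C_X\<close> and \<open>G_X\<close>\<close>

text \<open>\<open>C_X\<close> sees the difference \<open>h\<close> only after division by its
  \<open>L1norm\<close> \<open>L\<close>, so the convexity estimate is applied at level
  \<open>s = t * L\<close>. Because \<open>L\<close> is at least \<open>\<epsilon>\<close>, the
  factor \<open>L^2\<close> yields the required \<open>\<epsilon>^2\<close>.\<close>

lemma (in prob_space) K_X_le_convexity_gap:
  assumes X: "closed_L1_subspace M X" and f: "f \<in> unit_sphere (luxemburg M) X" and g: "g \<in> unit_sphere (luxemburg M) X"
    and \<epsilon>: "0 < \<epsilon>" "luxemburg M (\<lambda>x. f x - g x) = \<epsilon>"
  shows "K_X M X (1 / 5408) * ereal (\<epsilon>\<^sup>2) \<le> ereal (1 - luxemburg M (\<lambda>x. (f x + g x) / 2))"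
proof -
  define d where "d = 1 - luxemburg M (\<lambda>x. (f x + g x) / 2)"
  have int: "integrable M f" "integrable M g" and norm: "luxemburg M f = 1" "luxemburg M g = 1"
    and mem: "f \<in> X" "g \<in> X"
    using X f g by (auto simp: closed_L1_subspace_def unit_sphere_def)
  define h where "h = (\<lambda>x. f x - g x)"
  define L where "L = L1norm M h"
  have "integrable M h"
    using int by (simp add: h_def)
  then have L: "0 < \<epsilon>" "\<epsilon> \<le> L"
    using luxemburg_le_L1norm[of M h] \<epsilon> by (auto simp: L_def h_def)
  have "(\<lambda>x. (- 1) * g x) \<in> X"
    using X mem unfolding closed_L1_subspace_def by blast
  moreover have "\<forall>f\<in>X. \<forall>g\<in>X. (\<lambda>x. f x + g x) \<in> X"
    using X unfolding closed_L1_subspace_def by blast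
  ultimately have "(\<lambda>x. f x + (- 1) * g x) \<in> X"
    using mem(1) by (metis (no_types))
  then have "h \<in> X"
    by (simp add: h_def)
  then have hL: "(\<lambda>x. 1 / L * h x) \<in> X" "L1norm M (\<lambda>x. 1 / L * h x) = 1"
    using X L unfolding closed_L1_subspace_def L1norm_mult by (blast, auto simp: L_def)
  have "ereal (t\<^sup>2) * C_X M X t ^ 3 \<le> ereal (5408 * d / \<epsilon>\<^sup>2)" if t: "0 < t" "t < 1" for t
  proof -
    \<comment> \<open>Lying between 0 and a real value, \<open>C_X M X t\<close> is finite, so its
      cube can be treated in real arithmetic.\<close>
    have "0 \<le> C_X M X t"
      unfolding C_X_def by (intro Inf_greatest) (auto simp: distfun_def)
    moreover have C_le: "C_X M X t \<le> ereal (distfun M (\<lambda>x. 1 / L * h x) t)"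
      unfolding C_X_def using hL by (intro Inf_lower) auto
    ultimately obtain c where c: "C_X M X t = ereal c" "0 \<le> c"
      by (cases "C_X M X t") auto
    have "distfun M (\<lambda>x. 1 / L * h x) t = distfun M h (t * L)"
      unfolding distfun_def using L by (simp add: abs_mult field_simps)
    then have "(t * L)\<^sup>2 * c ^ 3 / 5408 \<le> d"
      using C_le c t L int norm unfolding d_def
      by (intro luxemburg_convexity) (auto simp: h_def)
    moreover have "\<epsilon>\<^sup>2 * (t\<^sup>2 * c ^ 3) \<le> L\<^sup>2 * (t\<^sup>2 * c ^ 3)"
      using L c by (intro mult_right_mono power_mono) auto
    ultimately have "t\<^sup>2 * c ^ 3 \<le> 5408 * d / \<epsilon>\<^sup>2"
      using L by (simp add: field_simps power_mult_distrib)
    then show ?thesis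
      by (simp add: c)
  qed
  then have "Sup {ereal (t\<^sup>2) * C_X M X t ^ 3 | t. 0 < t \<and> t < 1} \<le> ereal (5408 * d / \<epsilon>\<^sup>2)"
    by (intro Sup_least) auto
  then have "K_X M X (1 / 5408) \<le> ereal (1 / 5408) * ereal (5408 * d / \<epsilon>\<^sup>2)"
    unfolding K_X_def by (intro ereal_mult_left_mono) auto
  then have "K_X M X (1 / 5408) * ereal (\<epsilon>\<^sup>2) \<le> ereal (1 / 5408) * ereal (5408 * d / \<epsilon>\<^sup>2) * ereal (\<epsilon>\<^sup>2)"
    by (intro ereal_mult_right_mono) auto
  also have "\<dots> = ereal d"
    using L by simp
  finally show ?thesis
    by (simp add: d_def)
qed

lemma (in prob_space) luxemburg_smoothness_le_G_X:
  assumes X: "closed_L1_subspace M X" and f: "f \<in> unit_sphere (luxemburg M) X" and g: "g \<in> unit_sphere (luxemburg M) X"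
    and \<tau>: "0 < \<tau>"
  shows "ereal ((luxemburg M (\<lambda>x. f x + \<tau> * g x) + luxemburg M (\<lambda>x. f x - \<tau> * g x)) / 2 - 1)
    \<le> ereal (3456 * \<tau>\<^sup>2) * enn2ereal (\<integral>\<^sup>+ t. G_X M X t * indicator {0..1/\<tau>} t \<partial>lborel)"
proof -
  define J where "J = (\<integral>\<^sup>+ t. G_X M X t * indicator {0..1/\<tau>} t \<partial>lborel)"
  have int: "integrable M f" "integrable M g" and norm: "luxemburg M f = 1" "luxemburg M g = 1"
    and mem: "f \<in> X" "g \<in> X"
    using X f g by (auto simp: closed_L1_subspace_def unit_sphere_def)
  show ?thesis
  \<comment> \<open>If \<open>J\<close> is infinite, so is the right side, because
    \<open>\<tau> > 0\<close>. Otherwise the constant is \<open>3456 = 48 * (36 + 36)\<close>, which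
    also covers the \<open>8 * 36\<close> of the case of large \<open>\<tau>\<close>.\<close>
  proof (cases J)
    case top
    then show ?thesis
      using \<tau> by (simp add: J_def[symmetric])
  next
    case (real j)
    have le: "(\<integral>x. msq (\<tau> * h x) \<partial>M) \<le> 36 * (\<tau>\<^sup>2 * j)" if "h \<in> X" "luxemburg M h = 1" for h
    proof -
      have "ennreal (\<integral>x. msq (\<tau> * h x) \<partial>M) \<le> ennreal (36 * \<tau>\<^sup>2) * ennreal j"
        using integral_msq_le_G_X[OF X that \<tau>] real by (simp add: J_def)
      also have "\<dots> = ennreal (36 * (\<tau>\<^sup>2 * j))"
        using real by (simp add: ennreal_mult[symmetric] mult.assoc)
      finally show ?thesis
        using real by (subst (asm) ennreal_le_iff) auto
    qed
    have "(luxemburg M (\<lambda>x. f x + \<tau> * g x) + luxemburg M (\<lambda>x. f x - \<tau> * g x)) / 2 - 1 \<le> 3456 * (\<tau>\<^sup>2 * j)"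
    proof (cases "\<tau> \<le> 1/2")
      case True
      have "48 * ((\<integral>x. msq (\<tau> * f x) \<partial>M) + (\<integral>x. msq (\<tau> * g x) \<partial>M)) \<le> 48 * (72 * (\<tau>\<^sup>2 * j))"
        using le[OF mem(1) norm(1)] le[OF mem(2) norm(2)] by simp
      then show ?thesis
        using luxemburg_smoothness[OF int(1) norm(1) int(2) norm(2) \<tau> True] by simp
    next
      case False
      moreover have "0 \<le> \<tau>\<^sup>2 * j"
        using real by simp
      ultimately show ?thesis
        using luxemburg_smoothness_large[OF int(1) norm(1) int(2) norm(2), of \<tau>] le[OF mem(1) norm(1)]
        by linarith
    qed
    then show ?thesis
      using real by (simp add: J_def[symmetric] enn2ereal_ennreal mult.assoc)
  qed
qed

theorem theorem1p1:
  fixes M :: "'a measure"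
  assumes "prob_space M"
  shows "\<exists>N K1 K2. equiv_L1_norm M N \<and> 0 < K1 \<and> 0 < K2 \<and>
    (\<forall>X. closed_L1_subspace M X \<longrightarrow>
      (\<forall>\<epsilon>. 0 < \<epsilon> \<and> \<epsilon> \<le> 2 \<longrightarrow> mod_convexity N X \<epsilon> \<ge> K_X M X K1 * ereal (\<epsilon>^2)) \<and>
      (\<forall>\<tau>>0. mod_smoothness N X \<tau> \<le>
         ereal (K2 * \<tau>^2) * enn2ereal (\<integral>\<^sup>+ t. G_X M X t * indicator {0..1/\<tau>} t \<partial>lborel)))"
proof -
  interpret prob_space M by fact
  show ?thesis
  proof (rule exI[of _ "luxemburg M"], rule exI[of _ "1 / 5408"], rule exI[of _ 3456], intro conjI allI impI)
    show "equiv_L1_norm M (luxemburg M)"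
      by (rule equiv_L1_norm_luxemburg)
  next
    fix X and \<epsilon> :: real assume "closed_L1_subspace M X" "0 < \<epsilon> \<and> \<epsilon> \<le> 2"
    then show "K_X M X (1 / 5408) * ereal (\<epsilon>^2) \<le> mod_convexity (luxemburg M) X \<epsilon>"
      unfolding mod_convexity_def by (intro Inf_greatest) (auto intro: K_X_le_convexity_gap)
  next
    fix X and \<tau> :: real assume "closed_L1_subspace M X" "0 < \<tau>"
    then show "mod_smoothness (luxemburg M) X \<tau> \<le>
         ereal (3456 * \<tau>^2) * enn2ereal (\<integral>\<^sup>+ t. G_X M X t * indicator {0..1/\<tau>} t \<partial>lborel)"
      unfolding mod_smoothness_def by (intro Sup_least) (auto intro: luxemburg_smoothness_le_G_X)
  qed auto
qed

end
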